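(* For every $L>0$, every step size $\eta>0$, every momentum coefficient $\mu\in[0,1)$ and either momentum variant (standard or Nesterov), there exist a differentiable function $f:\mathbb{R}^{2\times2}\to\mathbb{R}$ that is bounded below and $L$-smooth in the sense that $$\|\nabla f(\mathbf{X})-\nabla f(\mathbf{Y})\|_*\le L\,\|\mathbf{X}-\mathbf{Y}\|_{2\to2}\qquad\text{for all }\mathbf{X},\mathbf{Y}\in\mathbb{R}^{2\times 2},$$ and a constant $c=c(f)>0$, such that EF21-SignMuon run on $f$ with constant step size $\eta$, momentum coefficient $\mu$ and the given momentum variant, started at $\mathbf{X}_0=\mathbf{0}$, diverges: $$f(\mathbf{X}_{t+2})-f(\mathbf{X}_t)=c\,L\,\eta^2>0\qquad\text{for all }t\ge3,$$ so that $f(\mathbf{X}_t)\to+\infty$. In particular, no step-size rule $\eta=\eta(L,\mu)$ that uses only the smoothness constant and the momentum coefficient can make the method convergent on all $L$-smooth, bounded-below functions.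
   Context: $\|\cdot\|_{2\to2}$ is the spectral norm and $\|\cdot\|_*$ the nuclear norm. For a matrix $\mathbf{M}$ of rank $r$ with thin singular value decomposition $\mathbf{M}=\mathbf{U}\boldsymbol{\Sigma}\mathbf{V}^\top$ (one column of $\mathbf{U}$ and of $\mathbf{V}$ per nonzero singular value), $\operatorname{polar}(\mathbf{M}):=\mathbf{U}\mathbf{V}^\top$. $\operatorname{sign}(\cdot)$ acts entrywise with values in $\{\pm1\}$, exact zeros being resolved to an arbitrary (random) $\pm1$. $\operatorname{mean}|\mathbf{Y}|$ is the average of the absolute values of the entries of $\mathbf{Y}$. EF21-SignMuon with exact gradients: $\mathbf{M}_0=\mathbf{0}$, $\mathbf{d}^{\mathrm{est}}_0=\mathbf{0}$ and, for $t\ge1$, $\mathbf{G}_t=\nabla f(\mathbf{X}_{t-1})$, $\mathbf{M}_t=\mu\mathbf{M}_{t-1}+(1-\mu)\mathbf{G}_t$; $\tilde{\mathbf{M}}_t=\mathbf{M}_t$ (standard) or $\tilde{\mathbf{M}}_t=(1-\mu)\mathbf{G}_t+\mu\mathbf{M}_t$ (Nesterov); $\mathbf{D}_t=\operatorname{polar}(\tilde{\mathbf{M}}_t)$; $\alpha_t=\operatorname{mean}|\mathbf{D}_t-\mathbf{d}^{\mathrm{est}}_{t-1}|$; $\mathbf{d}^{\mathrm{est}}_t=\mathbf{d}^{\mathrm{est}}_{t-1}+\alpha_t\operatorname{sign}(\mathbf{D}_t-\mathbf{d}^{\mathrm{est}}_{t-1})$; $\mathbf{X}_t=\mathbf{X}_{t-1}-\eta\,\mathbf{d}^{\mathrm{est}}_t$.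 *)

theory Defs
  imports "HOL-Analysis.Analysis"
begin

definition spectral_norm :: "real^'n^'m \<Rightarrow> real" where
  "spectral_norm A = onorm (\<lambda>x. A *v x)"

definition outer :: "real^'m \<Rightarrow> real^'n \<Rightarrow> real^'n^'m" where
  "outer u v = (\<chi> i j. u $ i * v $ j)"

text \<open>
  The rank \<open>r\<close> depends on the matrix, so the thin factors cannot be typed as matrices with
  \<open>r\<close> columns. They are given by their columns \<open>u 0, \<dots>, u (r - 1)\<close> and \<open>v 0, \<dots>, v (r - 1)\<close>;
  the product of the first factor, the diagonal matrix of the \<open>\<sigma> i\<close> and the transpose of the
  second factor is then \<open>\<Sum>i<r. \<sigma> i *\<^sub>R outer (u i) (v i)\<close>.
\<close>

definition orthonormal_upto :: "nat \<Rightarrow> (nat \<Rightarrow> real^'n) \<Rightarrow> bool" where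
  "orthonormal_upto r u \<longleftrightarrow> (\<forall>i<r. \<forall>j<r. u i \<bullet> u j = (if i = j then 1 else 0))"

definition thin_svd ::
    "real^'n^'m \<Rightarrow> nat \<Rightarrow> (nat \<Rightarrow> real^'m) \<Rightarrow> (nat \<Rightarrow> real) \<Rightarrow> (nat \<Rightarrow> real^'n) \<Rightarrow> bool" where
  "thin_svd M r u \<sigma> v \<longleftrightarrow>
     orthonormal_upto r u \<and> orthonormal_upto r v \<and> (\<forall>i<r. \<sigma> i > 0) \<and>
     M = (\<Sum>i<r. \<sigma> i *\<^sub>R outer (u i) (v i))"

text \<open>
  The two descriptions below are well defined: a thin singular value decomposition always exists
  (\<open>thin_svd_exists\<close>) and the described values do not depend on its choice
  (\<open>polar_eq\<close>, \<open>nuclear_norm_eq\<close>).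
\<close>

definition polar :: "real^'n^'m \<Rightarrow> real^'n^'m" where
  "polar M = (THE D. \<exists>r u \<sigma> v. thin_svd M r u \<sigma> v \<and> D = (\<Sum>i<r. outer (u i) (v i)))"

definition nuclear_norm :: "real^'n^'m \<Rightarrow> real" where
  "nuclear_norm M = (THE s. \<exists>r u \<sigma> v. thin_svd M r u \<sigma> v \<and> s = (\<Sum>i<r. \<sigma> i))"

lemma outer_mult_vec: "outer u v *v x = (v \<bullet> x) *\<^sub>R u"
  by (simp add: outer_def matrix_vector_mult_def vec_eq_iff inner_vec_def sum_distrib_left
      mult.assoc mult.commute mult.left_commute)

lemma sum_mult_vec: "(\<Sum>i\<in>I. A i) *v x = (\<Sum>i\<in>I. A i *v x)" for A :: "'i \<Rightarrow> real^'n^'m"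
  by (induction I rule: infinite_finite_induct) (simp_all add: matrix_vector_mult_add_rdistrib)

lemma inner_outer: "A \<bullet> outer u v = u \<bullet> (A *v v)"
  by (simp add: outer_def matrix_vector_mult_def inner_vec_def sum_distrib_left
      mult.assoc mult.commute mult.left_commute)

lemma eq_if_inner_diff_nonpos:
  fixes x y :: "'a::real_inner"
  assumes "(x - y) \<bullet> (x - y) \<le> 0"
  shows "x = y"
proof -
  have "(x - y) \<bullet> (x - y) = 0" using assms inner_ge_zero[of "x - y"] by linarith
  then show ?thesis by simp
qed

lemma orthonormal_uptoD:
  "orthonormal_upto r u \<Longrightarrow> i < r \<Longrightarrow> j < r \<Longrightarrow> u i \<bullet> u j = (if i = j then 1 else 0)"
  by (auto simp: orthonormal_upto_def)

lemma inner_sum_orthonormal: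
  assumes "orthonormal_upto r u" "i < r"
  shows "u i \<bullet> (\<Sum>j<r. a j *\<^sub>R u j) = a i"
proof -
  have "u i \<bullet> (\<Sum>j<r. a j *\<^sub>R u j) = (\<Sum>j<r. if i = j then a j else 0)"
    unfolding inner_sum_right using assms by (intro sum.cong) (auto simp: orthonormal_uptoD)
  then show ?thesis using assms by simp
qed

lemma norm_sum_orthonormal:
  assumes "orthonormal_upto r u"
  shows "(norm (\<Sum>j<r. a j *\<^sub>R u j))\<^sup>2 = (\<Sum>j<r. (a j)\<^sup>2)"
  unfolding power2_norm_eq_inner inner_sum_left[of _ "{..<r}"]
  using assms by (auto intro!: sum.cong simp: inner_sum_orthonormal power2_eq_square)

lemma bessel:
  assumes "orthonormal_upto r v"
  shows "(\<Sum>j<r. (v j \<bullet> x)\<^sup>2) \<le> (norm x)\<^sup>2"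
proof -
  let ?p = "\<Sum>j<r. (v j \<bullet> x) *\<^sub>R v j"
  have "x \<bullet> ?p = (\<Sum>j<r. (v j \<bullet> x)\<^sup>2)"
    by (simp add: inner_sum_right power2_eq_square inner_commute)
  moreover have "?p \<bullet> ?p = (\<Sum>j<r. (v j \<bullet> x)\<^sup>2)"
    using norm_sum_orthonormal[OF assms, of "\<lambda>j. v j \<bullet> x"] by (simp add: power2_norm_eq_inner)
  moreover have "0 \<le> (x - ?p) \<bullet> (x - ?p)" by simp
  ultimately show ?thesis
    by (simp add: inner_diff_left inner_diff_right inner_commute power2_norm_eq_inner)
qed

lemma thin_svd_mult_vec:
  assumes "thin_svd M r u \<sigma> v"
  shows "M *v x = (\<Sum>i<r. (\<sigma> i * (v i \<bullet> x)) *\<^sub>R u i)"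
proof -
  have M: "M = (\<Sum>i<r. \<sigma> i *\<^sub>R outer (u i) (v i))" using assms by (simp add: thin_svd_def)
  show ?thesis
    by (subst M) (simp add: sum_mult_vec outer_mult_vec flip: scaleR_matrix_vector_assoc)
qed

lemma polar_factor_mult_vec:
  "(\<Sum>i<r. outer (u i) (v i)) *v x = (\<Sum>i<r. (v i \<bullet> x) *\<^sub>R u i)"
  by (simp add: sum_mult_vec outer_mult_vec)

lemma polar_factor_contraction:
  assumes "orthonormal_upto r u" "orthonormal_upto r v"
  shows "norm ((\<Sum>i<r. outer (u i) (v i)) *v x) \<le> norm x"
  unfolding polar_factor_mult_vec
  by (rule power2_le_imp_le)
     (simp_all add: norm_sum_orthonormal[OF assms(1)] bessel[OF assms(2)])

lemma thin_svd_inner: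
  assumes "thin_svd M r u \<sigma> v"
  shows "M \<bullet> W = (\<Sum>i<r. \<sigma> i * (u i \<bullet> (W *v v i)))"
proof -
  have M: "M = (\<Sum>i<r. \<sigma> i *\<^sub>R outer (u i) (v i))" using assms by (simp add: thin_svd_def)
  show ?thesis
    by (subst M) (simp add: inner_sum_left inner_outer inner_commute[of "outer _ _"])
qed

lemma thin_svd_inner_polar_factor:
  assumes "thin_svd M r u \<sigma> v"
  shows "M \<bullet> (\<Sum>i<r. outer (u i) (v i)) = (\<Sum>i<r. \<sigma> i)"
proof -
  have o: "orthonormal_upto r u" "orthonormal_upto r v" using assms by (auto simp: thin_svd_def)
  have "(\<Sum>j<r. outer (u j) (v j)) *v v i = u i" if "i < r" for i
  proof -
    have "(\<Sum>j<r. outer (u j) (v j)) *v v i = (\<Sum>j<r. if i = j then u j else 0)"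
      unfolding polar_factor_mult_vec using that o(2)
      by (intro sum.cong) (auto simp: orthonormal_uptoD)
    then show ?thesis using that by simp
  qed
  moreover have "u i \<bullet> u i = 1" if "i < r" for i using o that by (simp add: orthonormal_uptoD)
  ultimately show ?thesis unfolding thin_svd_inner[OF assms] by (intro sum.cong) auto
qed

lemma contraction_inner_le:
  assumes "thin_svd M r u \<sigma> v" and W: "\<And>x. norm (W *v x) \<le> norm x" and "i < r"
  shows "u i \<bullet> (W *v v i) \<le> 1"
proof -
  have "u i \<bullet> u i = 1" "v i \<bullet> v i = 1" using assms by (auto simp: thin_svd_def orthonormal_uptoD)
  then have "norm (u i) = 1" "norm (v i) = 1" by (auto simp: norm_eq_sqrt_inner)
  then show ?thesis using norm_cauchy_schwarz[of "u i" "W *v v i"] W[of "v i"] by simp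
qed

lemma polar_factor_unique:
  assumes 1: "thin_svd M r u \<sigma> v" and 2: "thin_svd M r' u' \<sigma>' v'"
  shows "(\<Sum>i<r. outer (u i) (v i)) = (\<Sum>i<r'. outer (u' i) (v' i))" (is "?W = ?W'")
proof -
  have o: "orthonormal_upto r u" "orthonormal_upto r v" "\<And>i. i < r \<Longrightarrow> \<sigma> i > 0"
    and o': "orthonormal_upto r' u'" "orthonormal_upto r' v'" "\<And>i. i < r' \<Longrightarrow> \<sigma>' i > 0"
    using 1 2 by (auto simp: thin_svd_def)
  have c: "norm (?W *v x) \<le> norm x" for x using polar_factor_contraction[OF o(1,2)] .
  have c': "norm (?W' *v x) \<le> norm x" for x using polar_factor_contraction[OF o'(1,2)] .
  have le: "M \<bullet> ?W' \<le> (\<Sum>i<r. \<sigma> i)" unfolding thin_svd_inner[OF 1]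
    using contraction_inner_le[OF 1 c'] o(3) by (intro sum_mono) (simp add: mult_left_le)
  have le': "M \<bullet> ?W \<le> (\<Sum>i<r'. \<sigma>' i)" unfolding thin_svd_inner[OF 2]
    using contraction_inner_le[OF 2 c] o'(3) by (intro sum_mono) (simp add: mult_left_le)
  have "(\<Sum>i<r. \<sigma> i * (u i \<bullet> (?W' *v v i))) = (\<Sum>i<r. \<sigma> i)"
    using le le' thin_svd_inner_polar_factor[OF 1] thin_svd_inner_polar_factor[OF 2]
      thin_svd_inner[OF 1, of ?W'] by linarith
  then have s0: "(\<Sum>i<r. \<sigma> i * (1 - u i \<bullet> (?W' *v v i))) = 0"
    by (simp add: right_diff_distrib sum_subtractf)
  have ev: "?W' *v v i = u i" if "i < r" for i
  proof -
    have "\<sigma> j * (1 - u j \<bullet> (?W' *v v j)) \<ge> 0" if "j < r" for j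
      using contraction_inner_le[OF 1 c' that] o(3)[OF that] by simp
    then have "\<sigma> i * (1 - u i \<bullet> (?W' *v v i)) = 0"
      using s0 that by (subst (asm) sum_nonneg_eq_0_iff) auto
    then have one: "u i \<bullet> (?W' *v v i) = 1" using o(3)[OF that] by simp
    have "u i \<bullet> u i = 1" "v i \<bullet> v i = 1" using o that by (auto simp: orthonormal_uptoD)
    moreover from this have "norm (v i) = 1" by (simp add: norm_eq_sqrt_inner)
    then have "(norm (?W' *v v i))\<^sup>2 \<le> 1" using c'[of "v i"] by (simp add: power_le_one)
    ultimately have "(?W' *v v i - u i) \<bullet> (?W' *v v i - u i) \<le> 0"
      using one by (simp add: inner_diff_left inner_diff_right inner_commute power2_norm_eq_inner)
    then show ?thesis by (rule eq_if_inner_diff_nonpos)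
  qed
  have "?W *v x = ?W' *v x" for x
  proof -
    let ?p = "\<Sum>i<r. (v i \<bullet> x) *\<^sub>R v i"
    have y: "v i \<bullet> (x - ?p) = 0" if "i < r" for i
      using inner_sum_orthonormal[OF o(2) that] by (simp add: inner_diff_right)
    then have "M *v (x - ?p) = 0" by (simp add: thin_svd_mult_vec[OF 1])
    then have z: "(\<Sum>i<r'. (\<sigma>' i * (v' i \<bullet> (x - ?p))) *\<^sub>R u' i) = 0"
      by (simp add: thin_svd_mult_vec[OF 2])
    have "v' i \<bullet> (x - ?p) = 0" if "i < r'" for i
      using inner_sum_orthonormal[OF o'(1) that, of "\<lambda>i. \<sigma>' i * (v' i \<bullet> (x - ?p))"] o'(3)[OF that]
      unfolding z by simp
    then have "?W' *v (x - ?p) = 0" by (simp only: polar_factor_mult_vec) simp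
    then have "?W' *v x = ?W' *v ?p" by (simp add: matrix_vector_mult_diff_distrib)
    also have "\<dots> = (\<Sum>i<r. (v i \<bullet> x) *\<^sub>R (?W' *v v i))"
      by (simp add: linear_sum[OF matrix_vector_mul_linear] matrix_vector_mult_scaleR)
    also have "\<dots> = (\<Sum>i<r. (v i \<bullet> x) *\<^sub>R u i)" by (intro sum.cong) (auto simp: ev)
    also have "\<dots> = ?W *v x" by (simp only: polar_factor_mult_vec)
    finally show ?thesis by simp
  qed
  then show ?thesis by (simp add: matrix_eq)
qed

lemma polar_eq:
  assumes "thin_svd M r u \<sigma> v"
  shows "polar M = (\<Sum>i<r. outer (u i) (v i))"
  unfolding polar_def using assms by (intro the_equality) (auto dest: polar_factor_unique)

lemma nuclear_norm_eq:
  assumes "thin_svd M r u \<sigma> v"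
  shows "nuclear_norm M = (\<Sum>i<r. \<sigma> i)"
  unfolding nuclear_norm_def
proof (intro the_equality)
  fix s assume "\<exists>r u \<sigma> v. thin_svd M r u \<sigma> v \<and> s = (\<Sum>i<r. \<sigma> i)"
  then obtain r' u' \<sigma>' v' where svd: "thin_svd M r' u' \<sigma>' v'" and s: "s = (\<Sum>i<r'. \<sigma>' i)"
    by blast
  show "s = (\<Sum>i<r. \<sigma> i)"
    unfolding s thin_svd_inner_polar_factor[OF svd, symmetric]
      polar_factor_unique[OF svd assms] by (rule thin_svd_inner_polar_factor[OF assms])
qed (use assms in auto)

lemma max_singular_pair:
  fixes M :: "real^'n^'m"
  assumes "M \<noteq> 0"
  obtains s u v where "s > 0" "norm u = 1" "norm v = 1"
    "M *v v = s *\<^sub>R u" "transpose M *v u = s *\<^sub>R v"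
proof -
  have "continuous_on (sphere 0 1) (\<lambda>x. norm (M *v x))"
    by (intro continuous_on_norm linear_continuous_on matrix_vector_mul_bounded_linear)
  then obtain v where v: "norm v = 1" and mx: "\<And>x. norm x = 1 \<Longrightarrow> norm (M *v x) \<le> norm (M *v v)"
    using continuous_attains_sup[of "sphere (0::real^'n) 1" "\<lambda>x. norm (M *v x)"] by auto
  define s where "s = norm (M *v v)"
  define u where "u = (1 / s) *\<^sub>R (M *v v)"
  have bound: "norm (M *v x) \<le> s * norm x" for x
  proof (cases "x = 0")
    case False
    then show ?thesis using mx[of "(1 / norm x) *\<^sub>R x"]
      by (simp add: matrix_vector_mult_scaleR s_def field_simps)
  qed simp
  have "s > 0"
  proof (rule ccontr)
    assume "\<not> s > 0"
    then have "s = 0" by (simp add: s_def)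
    then have "M *v x = 0" for x using bound[of x] by simp
    then have "M = 0" by (simp add: matrix_eq)
    then show False using assms by simp
  qed
  have Mv: "M *v v = s *\<^sub>R u" using \<open>s > 0\<close> by (simp add: u_def)
  have nu: "norm u = 1" using \<open>s > 0\<close> by (simp add: u_def flip: s_def)
  define w where "w = transpose M *v u"
  have adj: "w \<bullet> x = u \<bullet> (M *v x)" for x
    by (simp add: w_def dot_lmul_matrix)
  have "u \<bullet> u = 1" "v \<bullet> v = 1" using nu v by (simp_all flip: power2_norm_eq_inner)
  then have "w \<bullet> v = s" by (simp add: adj Mv)
  have "norm w \<le> s"
  proof -
    have "norm w * norm w = u \<bullet> (M *v w)"
      by (metis adj power2_eq_square power2_norm_eq_inner)
    also have "\<dots> \<le> norm u * norm (M *v w)" by (rule norm_cauchy_schwarz)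
    also have "\<dots> \<le> s * norm w" using bound[of w] nu by simp
    finally show ?thesis using \<open>s > 0\<close> by (cases "norm w = 0") auto
  qed
  then have "w \<bullet> w \<le> s * s"
    by (metis power2_eq_square power2_norm_eq_inner norm_ge_zero power_mono)
  then have "(w - s *\<^sub>R v) \<bullet> (w - s *\<^sub>R v) \<le> 0"
    using \<open>w \<bullet> v = s\<close> \<open>v \<bullet> v = 1\<close>
    by (simp add: inner_diff_left inner_diff_right inner_commute[of v w])
  then have "w = s *\<^sub>R v" by (rule eq_if_inner_diff_nonpos)
  then show ?thesis using that \<open>s > 0\<close> nu v Mv unfolding w_def by blast
qed

lemma thin_svd_exists:
  fixes M :: "real^'n^'m"
  shows "\<exists>r u \<sigma> v. thin_svd M r u \<sigma> v"
proof (induction "CARD('n) - dim {x. M *v x = 0}" arbitrary: M rule: less_induct)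
  case less
  show ?case
  proof (cases "M = 0")
    case True
    have "thin_svd M 0 (\<lambda>_. 0) (\<lambda>_. 0) (\<lambda>_. 0)"
      by (simp add: True thin_svd_def orthonormal_upto_def)
    then show ?thesis by blast
  next
    case False
    then obtain s a b where sab: "s > 0" "norm a = 1" "norm b = 1"
      and Mb: "M *v b = s *\<^sub>R a" and Ma: "transpose M *v a = s *\<^sub>R b"
      by (rule max_singular_pair)
    have aa: "a \<bullet> a = 1" "b \<bullet> b = 1" using sab by (auto simp flip: power2_norm_eq_inner)
    have aM: "a \<bullet> (M *v x) = s * (b \<bullet> x)" for x
    proof -
      have "a \<bullet> (M *v x) = (transpose M *v a) \<bullet> x"
        by (simp add: dot_lmul_matrix)
      then show ?thesis unfolding Ma by simp
    qed
    define N where "N = M - s *\<^sub>R outer a b"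
    have N: "N *v x = M *v x - (s * (b \<bullet> x)) *\<^sub>R a" for x
      by (simp add: N_def matrix_vector_mult_diff_rdistrib outer_mult_vec
          flip: scaleR_matrix_vector_assoc)
    have Nb: "N *v b = 0" by (simp add: N Mb aa)
    have aN: "a \<bullet> (N *v x) = 0" for x by (simp add: N aM inner_diff_right aa)
    have sub: "{x. M *v x = 0} \<subset> {x. N *v x = 0}"
    proof
      show "{x. M *v x = 0} \<subseteq> {x. N *v x = 0}"
      proof clarify
        fix x assume x: "M *v x = 0"
        with aM[of x] sab have "b \<bullet> x = 0" by simp
        with x show "N *v x = 0" by (simp add: N)
      qed
      have "M *v b \<noteq> 0" using Mb sab by auto
      then show "{x. M *v x = 0} \<noteq> {x. N *v x = 0}" using Nb by blast
    qed
    have ker: "span {x. A *v x = 0} = {x. A *v x = 0}" for A :: "real^'n^'m"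
      unfolding span_eq_iff by (simp add: subspace_def matrix_vector_right_distrib
          matrix_vector_mult_scaleR)
    have "dim {x. M *v x = 0} < dim {x. N *v x = 0}"
      using sub by (intro dim_psubset) (simp only: ker)
    moreover have "dim {x. N *v x = 0} \<le> CARD('n)"
      using dim_subset_UNIV[of "{x. N *v x = 0}"] by simp
    ultimately have "CARD('n) - dim {x. N *v x = 0} < CARD('n) - dim {x. M *v x = 0}"
      by linarith
    from less[OF this] obtain r u \<sigma> v where svd: "thin_svd N r u \<sigma> v" by blast
    then have o: "orthonormal_upto r u" "orthonormal_upto r v" "\<And>i. i < r \<Longrightarrow> \<sigma> i > 0"
      and Nsum: "N = (\<Sum>i<r. \<sigma> i *\<^sub>R outer (u i) (v i))" by (auto simp: thin_svd_def)
    have bv: "v i \<bullet> b = 0" if "i < r" for i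
      using inner_sum_orthonormal[OF o(1) that, of "\<lambda>i. \<sigma> i * (v i \<bullet> b)"] o(3)[OF that] Nb
      by (simp flip: thin_svd_mult_vec[OF svd])
    have au: "a \<bullet> u i = 0" if "i < r" for i
    proof -
      have "N *v v i = (\<Sum>j<r. if i = j then \<sigma> j *\<^sub>R u j else 0)"
        unfolding thin_svd_mult_vec[OF svd] using o that
        by (intro sum.cong) (auto simp: orthonormal_uptoD)
      then have "N *v v i = \<sigma> i *\<^sub>R u i" using that by simp
      then show ?thesis using aN[of "v i"] o(3)[OF that] by simp
    qed
    have "thin_svd M (Suc r) (u(r := a)) (\<sigma>(r := s)) (v(r := b))"
      unfolding thin_svd_def
    proof (intro conjI)
      show "orthonormal_upto (Suc r) (u(r := a))" "orthonormal_upto (Suc r) (v(r := b))"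
        using o au bv aa by (auto simp: orthonormal_upto_def less_Suc_eq inner_commute)
      show "\<forall>i<Suc r. (\<sigma>(r := s)) i > 0" using o sab by auto
      have "M = N + s *\<^sub>R outer a b" by (simp add: N_def)
      then show "M = (\<Sum>i<Suc r. (\<sigma>(r := s)) i *\<^sub>R outer ((u(r := a)) i) ((v(r := b)) i))"
        by (simp add: Nsum)
    qed
    then show ?thesis by blast
  qed
qed

text \<open>
  The inner product on matrices is the Frobenius inner product, so this is the usual matrix of
  partial derivatives wherever \<open>f\<close> is differentiable.
\<close>

definition gradient :: "(real^'n^'m \<Rightarrow> real) \<Rightarrow> real^'n^'m \<Rightarrow> real^'n^'m" where
  "gradient f X = (THE G. GDERIV f X :> G)"

lemma gradient_eq:
  assumes "GDERIV f X :> G"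
  shows "gradient f X = G"
  unfolding gradient_def
proof (rule the_equality)
  show "GDERIV f X :> G" by fact
next
  fix G' assume "GDERIV f X :> G'"
  then have "(\<lambda>h. h \<bullet> G') = (\<lambda>h. h \<bullet> G)"
    using assms unfolding gderiv_def by (rule has_derivative_unique)
  then show "G' = G" by (metis vector_eq_ldot)
qed

definition L_smooth :: "real \<Rightarrow> (real^'n^'m \<Rightarrow> real) \<Rightarrow> bool" where
  "L_smooth L f \<longleftrightarrow>
     (\<forall>X. f differentiable (at X)) \<and>
     (\<forall>X Y. nuclear_norm (gradient f X - gradient f Y) \<le> L * spectral_norm (X - Y))"

definition mean_abs :: "real^'n^'m \<Rightarrow> real" where
  "mean_abs Y = (\<Sum>i\<in>UNIV. \<Sum>j\<in>UNIV. \<bar>Y $ i $ j\<bar>) / (real CARD('m) * real CARD('n))"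

text \<open>Entries of \<open>Y\<close> that are exactly zero take their sign from the matrix \<open>Z\<close>.\<close>

definition sign_mat :: "real^'n^'m \<Rightarrow> real^'n^'m \<Rightarrow> real^'n^'m" where
  "sign_mat Z Y = (\<chi> i j. if Y $ i $ j = 0 then Z $ i $ j else sgn (Y $ i $ j))"

definition tie_breaking :: "(nat \<Rightarrow> real^'n^'m) \<Rightarrow> bool" where
  "tie_breaking \<xi> \<longleftrightarrow> (\<forall>t i j. \<xi> t $ i $ j \<in> {-1, 1})"

datatype momentum = Standard | Nesterov

text \<open>
  The state after \<open>t\<close> steps is the triple of the iterate, the momentum matrix and the running
  estimate; \<open>\<xi> t\<close> resolves the zero entries in step \<open>t\<close>.
\<close>

primrec ef21_state ::
    "(real^'n^'m \<Rightarrow> real) \<Rightarrow> real \<Rightarrow> real \<Rightarrow> momentum \<Rightarrow> (nat \<Rightarrow> real^'n^'m) \<Rightarrow> nat \<Rightarrow>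
     (real^'n^'m) \<times> (real^'n^'m) \<times> (real^'n^'m)" where
  "ef21_state f \<eta> \<mu> var \<xi> 0 = (0, 0, 0)"
| "ef21_state f \<eta> \<mu> var \<xi> (Suc t) =
     (let (X, M, d) = ef21_state f \<eta> \<mu> var \<xi> t;
          G = gradient f X;
          M' = \<mu> *\<^sub>R M + (1 - \<mu>) *\<^sub>R G;
          Mtilde = (case var of Standard \<Rightarrow> M' | Nesterov \<Rightarrow> (1 - \<mu>) *\<^sub>R G + \<mu> *\<^sub>R M');
          E = polar Mtilde - d;
          d' = d + mean_abs E *\<^sub>R sign_mat (\<xi> (Suc t)) E
      in (X - \<eta> *\<^sub>R d', M', d'))"

definition ef21_iterate ::
    "(real^'n^'m \<Rightarrow> real) \<Rightarrow> real \<Rightarrow> real \<Rightarrow> momentum \<Rightarrow> (nat \<Rightarrow> real^'n^'m) \<Rightarrow> nat \<Rightarrow> real^'n^'m" where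
  "ef21_iterate f \<eta> \<mu> var \<xi> t = fst (ef21_state f \<eta> \<mu> var \<xi> t)"

text \<open>
  Convergence of the function values. It is implied by convergence of the iterates when \<open>f\<close> is
  continuous, so its negation also excludes convergence of the iterates.
\<close>

definition ef21_convergent ::
    "(real^'n^'m \<Rightarrow> real) \<Rightarrow> real \<Rightarrow> real \<Rightarrow> momentum \<Rightarrow> (nat \<Rightarrow> real^'n^'m) \<Rightarrow> bool" where
  "ef21_convergent f \<eta> \<mu> var \<xi> \<longleftrightarrow> convergent (\<lambda>t. f (ef21_iterate f \<eta> \<mu> var \<xi> t))"

end

theory Submission
  imports Defs
begin

text \<open>
  The method normalises the gradient, so a run does not see its magnitude: multiplying the
  objective by a small positive constant leaves the iterates unchanged and makes the objective as
  smooth as desired. The method also sees the gradient at the iterates only. Hence, for a known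
  step size, an objective may point downhill at every iterate along the direction of travel and
  still climb between consecutive iterates.

  Fix the rank-one matrix \<open>D = outer u u\<close> with \<open>u = (1, 1) / sqrt 2\<close>, and consider
  a ridge function \<open>f X = K * \<phi> ((D \<bullet> X) / \<eta>)\<close>. Its gradients are multiples of
  \<open>D\<close>. As long as these multiples are positive, both momentum variants produce positive multiples
  of \<open>D\<close>, whose polar factor is \<open>D\<close>. All entries of \<open>D\<close> have the same absolute value, so the scaled
  sign compression of \<open>D\<close> is exact: the estimate equals \<open>D\<close> after one step, the later
  residuals vanish, and so does the influence of the tie-breaking. The iterates are
  \<open>X t = - (t * \<eta>) D\<close>, which \<open>\<phi>\<close> sees as the points \<open>0, -1, -2, \<dots>\<close>
  (\<open>ef21_state_flat_direction\<close>).

  It remains to choose \<open>\<phi>\<close> with Lipschitz derivative, bounded below, with \<open>\<phi>' > 0\<close> at all these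
  points and \<open>\<phi> (-t) = t\<close>. The function \<open>- y + sin (2 * pi * y)\<close> has the last two properties, since
  the sine vanishes at the integers with slope \<open>2 * pi > 1\<close>; the term \<open>(max 0 y)\<^sup>2\<close> makes it bounded
  below and changes nothing on the negative half-line. The constant \<open>K = L * \<eta>\<^sup>2 / C\<close>, for a
  Lipschitz constant \<open>C\<close> of \<open>\<phi>'\<close>, makes \<open>f\<close> \<open>L\<close>-smooth (\<open>L_smooth_ridge\<close>), and the gain over
  two steps is \<open>2 * K\<close>.
\<close>

section \<open>Rank-one matrices\<close>

lemma inner_outer_outer: "outer u v \<bullet> outer u v = (norm u)\<^sup>2 * (norm v)\<^sup>2"
  by (simp add: inner_outer outer_mult_vec power2_norm_eq_inner mult.commute)

lemma thin_svd_rank_one: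
  assumes "norm u = 1" "norm v = 1" "k > 0"
  shows "thin_svd (k *\<^sub>R outer u v) 1 (\<lambda>_. u) (\<lambda>_. k) (\<lambda>_. v)"
  using assms by (simp add: thin_svd_def orthonormal_upto_def flip: power2_norm_eq_inner)

lemma polar_rank_one:
  assumes "norm u = 1" "norm v = 1" "k > 0"
  shows "polar (k *\<^sub>R outer u v) = outer u v"
  using polar_eq[OF thin_svd_rank_one[OF assms]] by simp

lemma nuclear_norm_rank_one:
  assumes "norm u = 1" "norm v = 1"
  shows "nuclear_norm (k *\<^sub>R outer u v) = \<bar>k\<bar>"
proof -
  consider "k > 0" | "k = 0" | "k < 0" by linarith
  then show ?thesis
  proof cases
    case 1
    then show ?thesis using nuclear_norm_eq[OF thin_svd_rank_one[OF assms]] by simp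
  next
    case 2
    have "thin_svd (0 *\<^sub>R outer u v) 0 (\<lambda>_. u) (\<lambda>_. 0) (\<lambda>_. v)"
      by (simp add: thin_svd_def orthonormal_upto_def)
    from nuclear_norm_eq[OF this] 2 show ?thesis by simp
  next
    case 3
    \<comment> \<open>Singular values are positive, so the sign of \<open>k\<close> moves into a singular vector.\<close>
    have "outer (- u) v = - outer u v" by (simp add: outer_def vec_eq_iff)
    then have "k *\<^sub>R outer u v = (- k) *\<^sub>R outer (- u) v" by simp
    then show ?thesis
      using nuclear_norm_eq[OF thin_svd_rank_one[of "- u" v "- k"]] assms 3 by simp
  qed
qed

text \<open>One half of the duality between the nuclear and the spectral norm, for rank one.\<close>

lemma abs_inner_rank_one_le_spectral_norm:
  assumes "norm u = 1" "norm v = 1"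
  shows "\<bar>outer u v \<bullet> Z\<bar> \<le> spectral_norm Z"
proof -
  have "\<bar>outer u v \<bullet> Z\<bar> = \<bar>u \<bullet> (Z *v v)\<bar>" by (simp add: inner_commute[of "outer u v"] inner_outer)
  also have "\<dots> \<le> norm (Z *v v)" using Cauchy_Schwarz_ineq2[of u "Z *v v"] assms by simp
  also have "\<dots> \<le> spectral_norm Z"
    unfolding spectral_norm_def
    using onorm[OF matrix_vector_mul_bounded_linear[of Z], of v] assms by simp
  finally show ?thesis .
qed

section \<open>Ridge functions\<close>

lemma GDERIV_ridge:
  fixes D :: "real^'n^'m"
  assumes "(\<phi> has_real_derivative \<phi>') (at ((D \<bullet> X) / \<eta>))"
  shows "GDERIV (\<lambda>X. K * \<phi> ((D \<bullet> X) / \<eta>)) X :> (K * \<phi>' / \<eta>) *\<^sub>R D"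
proof -
  have "((\<lambda>X. (D \<bullet> X) / \<eta>) has_derivative (\<lambda>h. (D \<bullet> h) / \<eta>)) (at X)"
    unfolding divide_inverse by (auto intro!: derivative_eq_intros)
  from has_derivative_compose[OF this assms[unfolded has_field_derivative_def]]
  have "((\<lambda>X. K * \<phi> ((D \<bullet> X) / \<eta>)) has_derivative (\<lambda>h. K * (\<phi>' * ((D \<bullet> h) / \<eta>)))) (at X)"
    by (rule has_derivative_mult_right)
  then show ?thesis
    by (simp add: gderiv_def inner_commute mult.assoc)
qed

text \<open>
  The gradients all lie on one line, so the nuclear norm of their difference is a difference of
  slopes, and the spectral norm controls the argument of \<open>\<phi>\<close>. The factor \<open>\<eta>\<^sup>2\<close> undoes
  the two divisions by \<open>\<eta>\<close> in the second-order scaling.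
\<close>

lemma L_smooth_ridge:
  fixes u :: "real^'m" and v :: "real^'n"
  assumes uv: "norm u = 1" "norm v = 1" and pos: "L > 0" "\<eta> > 0" "C > 0"
    and der: "\<And>y. (\<phi> has_real_derivative \<phi>' y) (at y)"
    and lip: "\<And>y z. \<bar>\<phi>' y - \<phi>' z\<bar> \<le> C * \<bar>y - z\<bar>"
  shows "L_smooth L (\<lambda>X. L * \<eta>\<^sup>2 / C * \<phi> ((outer u v \<bullet> X) / \<eta>))" (is "L_smooth L ?f")
  unfolding L_smooth_def
proof (intro conjI allI)
  let ?D = "outer u v"
  have G: "GDERIV ?f X :> (L * \<eta>\<^sup>2 / C * \<phi>' ((?D \<bullet> X) / \<eta>) / \<eta>) *\<^sub>R ?D" for X
    by (rule GDERIV_ridge[OF der])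
  fix X Y
  show "?f differentiable (at X)"
    using G[of X] unfolding gderiv_def differentiable_def by blast
  define y z where "y = (?D \<bullet> X) / \<eta>" and "z = (?D \<bullet> Y) / \<eta>"
  have "gradient ?f X - gradient ?f Y = (L * \<eta> / C * (\<phi>' y - \<phi>' z)) *\<^sub>R ?D"
    unfolding gradient_eq[OF G] y_def[symmetric] z_def[symmetric] scaleR_left_diff_distrib[symmetric]
    using pos by (simp add: field_simps power2_eq_square)
  then have "nuclear_norm (gradient ?f X - gradient ?f Y) = L * \<eta> / C * \<bar>\<phi>' y - \<phi>' z\<bar>"
    using pos by (simp only: nuclear_norm_rank_one[OF uv]) (simp add: abs_mult)
  also have "\<dots> \<le> L * \<eta> / C * (C * \<bar>y - z\<bar>)"
    using pos by (intro mult_left_mono lip) simp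
  also have "\<dots> = L * \<bar>?D \<bullet> (X - Y)\<bar>"
    using pos by (simp add: y_def z_def inner_diff_right flip: diff_divide_distrib)
  also have "\<dots> \<le> L * spectral_norm (X - Y)"
    using pos abs_inner_rank_one_le_spectral_norm[OF uv] by (intro mult_left_mono) auto
  finally show "nuclear_norm (gradient ?f X - gradient ?f Y) \<le> L * spectral_norm (X - Y)" .
qed

section \<open>Runs along a flat direction\<close>

lemma mean_abs_flat:
  fixes D :: "real^'n^'m"
  assumes "\<And>i j. \<bar>D $ i $ j\<bar> = a"
  shows "mean_abs D = a"
  by (simp add: mean_abs_def assms)

lemma scaled_sign_flat:
  fixes D :: "real^'n^'m"
  assumes "\<And>i j. \<bar>D $ i $ j\<bar> = a" "a > 0"
  shows "mean_abs D *\<^sub>R sign_mat Z D = D"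
proof -
  have "D $ i $ j \<noteq> 0" "a * sgn (D $ i $ j) = D $ i $ j" for i j
    using assms(1)[of i j] assms(2) by (auto simp: sgn_if)
  then show ?thesis
    by (simp add: mean_abs_flat[OF assms(1)] sign_mat_def vec_eq_iff)
qed

text \<open>
  The hypothesis on the gradient speaks only of the points \<open>- (t * \<eta>) D\<close>, which the
  conclusion shows to be the iterates. The momentum is described up to a factor, which
  the polar factor ignores; the factor is zero only before the first step.
\<close>

lemma ef21_state_flat_direction:
  fixes u :: "real^'m" and v :: "real^'n"
  defines "D \<equiv> outer u v"
  assumes uv: "norm u = 1" "norm v = 1"
    and flat: "\<And>i j. \<bar>D $ i $ j\<bar> = a" "a > 0"
    and mu: "0 \<le> \<mu>" "\<mu> < 1"
    and grad: "\<And>t. gradient f (- (real t * \<eta>) *\<^sub>R D) = k t *\<^sub>R D" "\<And>t. k t > 0"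
  shows "\<exists>m\<ge>0. ef21_state f \<eta> \<mu> var \<xi> t =
    (- (real t * \<eta>) *\<^sub>R D, m *\<^sub>R D, if t = 0 then 0 else D)"
proof (induction t)
  case 0
  show ?case by (auto intro: exI[of _ 0])
next
  case (Suc t)
  then obtain m where m: "m \<ge> 0" and
    st: "ef21_state f \<eta> \<mu> var \<xi> t = (- (real t * \<eta>) *\<^sub>R D, m *\<^sub>R D, if t = 0 then 0 else D)"
    by blast
  define m' where "m' = \<mu> * m + (1 - \<mu>) * k t"
  define n where "n = (1 - \<mu>) * k t + \<mu> * m'"
  have m': "m' > 0" unfolding m'_def using m mu grad(2)[of t] by (intro add_nonneg_pos) auto
  have n: "n > 0" unfolding n_def using m' mu grad(2)[of t] by (intro add_pos_nonneg) auto
  have M': "\<mu> *\<^sub>R m *\<^sub>R D + (1 - \<mu>) *\<^sub>R k t *\<^sub>R D = m' *\<^sub>R D"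
    by (simp add: m'_def scaleR_add_left)
  have N: "(1 - \<mu>) *\<^sub>R k t *\<^sub>R D + \<mu> *\<^sub>R m' *\<^sub>R D = n *\<^sub>R D"
    by (simp add: n_def scaleR_add_left)
  have pol: "polar (case var of Standard \<Rightarrow> m' *\<^sub>R D | Nesterov \<Rightarrow> n *\<^sub>R D) = D"
    using polar_rank_one[OF uv m'] polar_rank_one[OF uv n]
    by (simp add: D_def split: momentum.split)
  \<comment> \<open>The residual is \<open>D\<close>, compressed without loss, in the first step and zero afterwards.\<close>
  have est: "d + mean_abs (D - d) *\<^sub>R sign_mat Z (D - d) = D"
    if "d = (if t = 0 then 0 else D)" for d Z
    using that scaled_sign_flat[OF flat] by (auto simp: mean_abs_def split: if_splits)
  have X: "- (real t * \<eta>) *\<^sub>R D - \<eta> *\<^sub>R D = - (real (Suc t) * \<eta>) *\<^sub>R D"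
    by (simp only: scaleR_left_diff_distrib[symmetric]) (simp add: algebra_simps)
  have "ef21_state f \<eta> \<mu> var \<xi> (Suc t) = (- (real (Suc t) * \<eta>) *\<^sub>R D, m' *\<^sub>R D, D)"
    by (simp only: ef21_state.simps st Let_def prod.case grad(1) M' N pol est X)
  then show ?case using m' by (auto intro!: exI[of _ m'])
qed

section \<open>A profile that climbs between its samples\<close>

definition profile :: "real \<Rightarrow> real" where
  "profile y = - y + (max 0 y)\<^sup>2 + sin (2 * pi * y)"

definition profile' :: "real \<Rightarrow> real" where
  "profile' y = - 1 + 2 * max 0 y + 2 * pi * cos (2 * pi * y)"

lemma has_real_derivative_max_0_power2:
  "((\<lambda>y::real. (max 0 y)\<^sup>2) has_real_derivative 2 * max 0 y) (at y)"
proof -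
  consider "y > 0" | "y < 0" | "y = 0" by linarith
  then show ?thesis
  proof cases
    case 1
    have "((\<lambda>y. y\<^sup>2) has_real_derivative 2 * max 0 y) (at y)"
      using 1 by (auto intro!: derivative_eq_intros)
    then show ?thesis
      by (rule has_field_derivative_transform_within_open[where S = "{0<..}"]) (use 1 in auto)
  next
    case 2
    have "((\<lambda>y. 0) has_real_derivative 2 * max 0 y) (at y)"
      using 2 by (auto intro!: derivative_eq_intros)
    then show ?thesis
      by (rule has_field_derivative_transform_within_open[where S = "{..<0}"]) (use 2 in auto)
  next
    case 3
    \<comment> \<open>The difference quotient at zero is \<open>max 0 h\<close>.\<close>
    have "((\<lambda>h. max 0 h) \<longlongrightarrow> (0::real)) (at 0)"
      using tendsto_max[OF tendsto_const[of 0 "at (0::real)"] tendsto_ident_at[of 0 UNIV]] by simp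
    then have "((\<lambda>h. ((max 0 (0 + h))\<^sup>2 - (max 0 0)\<^sup>2) / h) \<longlongrightarrow> (0::real)) (at 0)"
      by (rule Lim_transform_eventually)
         (auto simp: eventually_at_filter power2_eq_square max_def)
    then show ?thesis unfolding 3 DERIV_def by simp
  qed
qed

lemma has_real_derivative_profile: "(profile has_real_derivative profile' y) (at y)"
  unfolding profile_def [abs_def] profile'_def
  by (rule has_real_derivative_max_0_power2 derivative_eq_intros refl | simp)+

lemma abs_cos_diff_le: "\<bar>cos x - cos y\<bar> \<le> \<bar>x - y\<bar>" for x y :: real
proof -
  have "norm (cos x - cos y) \<le> 1 * norm (x - y)"
  proof (rule field_differentiable_bound[where S = UNIV and f' = "\<lambda>x. - sin x"])
    show "(cos has_field_derivative - sin z) (at z within UNIV)" for z :: real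
      by (rule DERIV_cos)
  qed auto
  then show ?thesis by simp
qed

lemma profile'_lipschitz: "\<bar>profile' y - profile' z\<bar> \<le> (2 + 4 * pi\<^sup>2) * \<bar>y - z\<bar>"
proof -
  have "\<bar>cos (2 * pi * y) - cos (2 * pi * z)\<bar> \<le> \<bar>2 * pi * y - 2 * pi * z\<bar>"
    by (rule abs_cos_diff_le)
  also have "\<dots> = 2 * pi * \<bar>y - z\<bar>"
    by (simp add: abs_mult flip: right_diff_distrib)
  finally have "2 * pi * \<bar>cos (2 * pi * y) - cos (2 * pi * z)\<bar> \<le> 2 * pi * (2 * pi * \<bar>y - z\<bar>)"
    by (intro mult_left_mono) auto
  moreover have "\<bar>2 * pi * cos (2 * pi * y) - 2 * pi * cos (2 * pi * z)\<bar>
      = 2 * pi * \<bar>cos (2 * pi * y) - cos (2 * pi * z)\<bar>"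
    by (simp add: abs_mult flip: right_diff_distrib)
  moreover have "\<bar>max 0 y - max 0 z\<bar> \<le> \<bar>y - z\<bar>" by linarith
  moreover have "profile' y - profile' z
      = 2 * (max 0 y - max 0 z) + (2 * pi * cos (2 * pi * y) - 2 * pi * cos (2 * pi * z))"
    by (simp add: profile'_def)
  moreover have "\<bar>2 * a + b\<bar> \<le> 2 * \<bar>a\<bar> + \<bar>b\<bar>" for a b :: real by linarith
  ultimately have "\<bar>profile' y - profile' z\<bar> \<le> 2 * \<bar>y - z\<bar> + 2 * pi * (2 * pi * \<bar>y - z\<bar>)"
    by (smt (verit))
  then show ?thesis by (simp add: algebra_simps power2_eq_square)
qed

lemma profile_ge: "profile y \<ge> - 2"
proof -
  have "- y + (max 0 y)\<^sup>2 \<ge> - 1"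
  proof (cases "y \<le> 0")
    case False
    have "0 \<le> (y - 1 / 2)\<^sup>2" by simp
    then show ?thesis using False by (simp add: power2_eq_square algebra_simps)
  qed simp
  moreover have "sin (2 * pi * y) \<ge> - 1" by (rule sin_ge_minus_one)
  ultimately show ?thesis unfolding profile_def by linarith
qed

lemma profile_neg_nat: "profile (- real t) = real t"
  using sin_integer_2pi[of "- real t"] by (simp add: profile_def)

lemma profile'_neg_nat_pos: "profile' (- real t) > 0"
  using cos_integer_2pi[of "- real t"] pi_gt3 by (simp add: profile'_def)

section \<open>Divergence\<close>

text \<open>
  The gain over two steps is a fixed multiple of \<open>L * \<eta>\<^sup>2\<close>, so the constant depends on none of
  the parameters.
\<close>

lemma ef21_diverges:
  fixes L \<eta> \<mu> :: real and var :: momentum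
  assumes pos: "L > 0" "\<eta> > 0" and mu: "\<mu> \<in> {0..<1}"
  shows "\<exists>f :: real^2^2 \<Rightarrow> real. \<exists>c>0.
    bdd_below (range f) \<and> L_smooth L f \<and>
    (\<forall>\<xi>. tie_breaking \<xi> \<longrightarrow>
       (\<forall>t\<ge>3. f (ef21_iterate f \<eta> \<mu> var \<xi> (t + 2)) - f (ef21_iterate f \<eta> \<mu> var \<xi> t)
                = c * L * \<eta>\<^sup>2 \<and> c * L * \<eta>\<^sup>2 > 0) \<and>
       filterlim (\<lambda>t. f (ef21_iterate f \<eta> \<mu> var \<xi> t)) at_top sequentially)"
proof -
  define u :: "real^2" where "u = (\<chi> i. 1 / sqrt 2)"
  define D where "D = outer u u"
  define C where "C = 2 + 4 * pi\<^sup>2"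
  define K where "K = L * \<eta>\<^sup>2 / C"
  define f :: "real^2^2 \<Rightarrow> real" where "f X = K * profile ((D \<bullet> X) / \<eta>)" for X
  have u: "norm u = 1"
    by (simp add: norm_eq_sqrt_inner inner_vec_def u_def)
  have flat: "\<bar>D $ i $ j\<bar> = 1 / 2" for i j
    by (simp add: D_def outer_def u_def)
  have DD: "D \<bullet> D = 1" by (simp add: D_def inner_outer_outer u)
  have C: "C > 0" unfolding C_def by (intro add_pos_nonneg) auto
  have K: "K > 0" using pos C by (simp add: K_def)
  have sample: "(D \<bullet> (- (real t * \<eta>) *\<^sub>R D)) / \<eta> = - real t" for t
    using pos by (simp add: DD)
  have grad: "gradient f (- (real t * \<eta>) *\<^sub>R D) = (K * profile' (- real t) / \<eta>) *\<^sub>R D" for t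
    unfolding f_def[abs_def]
    by (rule gradient_eq, rule GDERIV_ridge, unfold sample, rule has_real_derivative_profile)
  have "ef21_iterate f \<eta> \<mu> var \<xi> t = - (real t * \<eta>) *\<^sub>R D" for \<xi> t
  proof -
    have "\<exists>m\<ge>0. ef21_state f \<eta> \<mu> var \<xi> t = (- (real t * \<eta>) *\<^sub>R D, m *\<^sub>R D, if t = 0 then 0 else D)"
      unfolding D_def
      by (rule ef21_state_flat_direction[where a = "1 / 2" and k = "\<lambda>t. K * profile' (- real t) / \<eta>"])
         (use u flat mu grad K pos profile'_neg_nat_pos in \<open>auto simp: D_def[symmetric]\<close>)
    then show ?thesis by (auto simp: ef21_iterate_def)
  qed
  then have val: "f (ef21_iterate f \<eta> \<mu> var \<xi> t) = K * real t" for \<xi> t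
    by (simp only: f_def sample profile_neg_nat)
  have "bdd_below (range f)"
    using K profile_ge by (intro bdd_belowI2[of _ "K * - 2"]) (simp only: f_def mult_left_mono less_imp_le)
  moreover have "L_smooth L f"
    unfolding f_def[abs_def] K_def D_def
    by (rule L_smooth_ridge[OF u u pos C has_real_derivative_profile])
       (unfold C_def, rule profile'_lipschitz)
  moreover have "K * real (t + 2) - K * real t = (2 / C) * L * \<eta>\<^sup>2" for t
    by (simp add: K_def algebra_simps add_divide_distrib)
  moreover have "2 / C > 0" using C by simp
  moreover have "2 / C * L * \<eta>\<^sup>2 > 0" using C pos by simp
  moreover have "filterlim (\<lambda>t. K * real t) at_top sequentially"
    by (rule filterlim_tendsto_pos_mult_at_top[OF tendsto_const K filterlim_real_sequentially])
  ultimately show ?thesis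
    by (intro exI[of _ f] exI[of _ "2 / C"]) (simp only: val, blast)
qed

theorem theorem4:
  shows
    "(\<forall>L>0. \<forall>\<eta>>0. \<forall>\<mu>\<in>{0..<1}. \<forall>var :: momentum.
        \<exists>f :: real^2^2 \<Rightarrow> real. \<exists>c>0.
          bdd_below (range f) \<and> L_smooth L f \<and>
          (\<forall>\<xi>. tie_breaking \<xi> \<longrightarrow>
             (\<forall>t\<ge>3. f (ef21_iterate f \<eta> \<mu> var \<xi> (t + 2)) - f (ef21_iterate f \<eta> \<mu> var \<xi> t)
                      = c * L * \<eta>\<^sup>2 \<and> c * L * \<eta>\<^sup>2 > 0) \<and>
             filterlim (\<lambda>t. f (ef21_iterate f \<eta> \<mu> var \<xi> t)) at_top sequentially))
     \<and>
     (\<forall>rule :: real \<Rightarrow> real \<Rightarrow> real.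
        (\<forall>L>0. \<forall>\<mu>\<in>{0..<1}. rule L \<mu> > 0) \<longrightarrow>
        (\<forall>L>0. \<forall>\<mu>\<in>{0..<1}. \<forall>var :: momentum.
          \<exists>f :: real^2^2 \<Rightarrow> real.
            bdd_below (range f) \<and> L_smooth L f \<and>
            (\<forall>\<xi>. tie_breaking \<xi> \<longrightarrow> \<not> ef21_convergent f (rule L \<mu>) \<mu> var \<xi>)))"
proof (intro conjI allI impI ballI)
  fix L \<eta> \<mu> :: real and var :: momentum
  assume "L > 0" "\<eta> > 0" "\<mu> \<in> {0..<1}"
  then show "\<exists>f :: real^2^2 \<Rightarrow> real. \<exists>c>0.
    bdd_below (range f) \<and> L_smooth L f \<and>
    (\<forall>\<xi>. tie_breaking \<xi> \<longrightarrow>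
       (\<forall>t\<ge>3. f (ef21_iterate f \<eta> \<mu> var \<xi> (t + 2)) - f (ef21_iterate f \<eta> \<mu> var \<xi> t)
                = c * L * \<eta>\<^sup>2 \<and> c * L * \<eta>\<^sup>2 > 0) \<and>
       filterlim (\<lambda>t. f (ef21_iterate f \<eta> \<mu> var \<xi> t)) at_top sequentially)"
    by (rule ef21_diverges)
next
  fix rule :: "real \<Rightarrow> real \<Rightarrow> real" and L \<mu> :: real and var :: momentum
  assume "\<forall>L>0. \<forall>\<mu>\<in>{0..<1}. rule L \<mu> > 0" and L: "L > 0" and mu: "\<mu> \<in> {0..<1}"
  then have "rule L \<mu> > 0" by blast
  from ef21_diverges[OF L this mu, of var] obtain f :: "real^2^2 \<Rightarrow> real" where
    "bdd_below (range f)" "L_smooth L f" and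
    lim: "\<And>\<xi>. tie_breaking \<xi> \<Longrightarrow>
      filterlim (\<lambda>t. f (ef21_iterate f (rule L \<mu>) \<mu> var \<xi> t)) at_top sequentially"
    by blast
  moreover have "\<not> ef21_convergent f (rule L \<mu>) \<mu> var \<xi>" if "tie_breaking \<xi>" for \<xi>
  proof
    assume "ef21_convergent f (rule L \<mu>) \<mu> var \<xi>"
    then obtain l where "(\<lambda>t. f (ef21_iterate f (rule L \<mu>) \<mu> var \<xi> t)) \<longlonglongrightarrow> l"
      unfolding ef21_convergent_def convergent_def by blast
    then show False
      using not_tendsto_and_filterlim_at_infinity[OF sequentially_bot]
        filterlim_at_top_imp_at_infinity[OF lim[OF that]] by blast
  qed
  ultimately show "\<exists>f :: real^2^2 \<Rightarrow> real.
      bdd_below (range f) \<and> L_smooth L f \<and>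
      (\<forall>\<xi>. tie_breaking \<xi> \<longrightarrow> \<not> ef21_convergent f (rule L \<mu>) \<mu> var \<xi>)"
    by blast
qed

end
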